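(* Let $\mathbb{K}$ be a field, let $V$ be a vector space over $\mathbb{K}$ with finite positive dimension, let $A, A^*$ be a Leonard pair on $V$, and let $d=\dim V-1$. Then the following hold. (i) Suppose $d$ is odd. Then $AA^*-A^*A$ is invertible. (ii) Suppose $d$ is even. Then the null space of $AA^*-A^*A$ has dimension $1$.
   Context: A square matrix is tridiagonal if each nonzero entry lies on the diagonal, the subdiagonal or the superdiagonal; a tridiagonal matrix is irreducible if each entry on the subdiagonal is nonzero and each entry on the superdiagonal is nonzero. A Leonard pair on $V$ is an ordered pair of linear transformations $A:V\to V$ and $A^*:V\to V$ such that: (i) there exists a basis for $V$ with respect to which the matrix representing $A$ is irreducible tridiagonal and the matrix representing $A^*$ is diagonal; (ii) there exists a basis for $V$ with respect to which the matrix representing $A^*$ is irreducible tridiagonal and the matrix representing $A$ is diagonal. Here $A^*$ is just a name for a second linear transformation; it does not denote the conjugate-transpose or adjoint of $A$. The null space of a linear transformation $X:V\to V$ is $\{v\in V \mid Xv=0\}$. *)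

theory Defs
  imports "HOL.Vector_Spaces" "Jordan_Normal_Form.Matrix"
begin

definition tridiagonal_mat :: "'a::zero mat \<Rightarrow> bool" where
  "tridiagonal_mat M \<longleftrightarrow> square_mat M \<and>
     (\<forall>i < dim_row M. \<forall>j < dim_col M.
        M $$ (i, j) \<noteq> 0 \<longrightarrow> i = j \<or> i = Suc j \<or> j = Suc i)"

definition irreducible_tridiagonal_mat :: "'a::zero mat \<Rightarrow> bool" where
  "irreducible_tridiagonal_mat M \<longleftrightarrow> tridiagonal_mat M \<and>
     (\<forall>i. Suc i < dim_row M \<longrightarrow> M $$ (Suc i, i) \<noteq> 0 \<and> M $$ (i, Suc i) \<noteq> 0)"

text \<open>The vector space is a whole type, with its scalar multiplication \<open>scale\<close> passed explicitly;
  the definitions below are meant for \<open>vector_space scale\<close>.\<close>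

definition ordered_basis :: "('k::field \<Rightarrow> 'v::ab_group_add \<Rightarrow> 'v) \<Rightarrow> 'v list \<Rightarrow> bool" where
  "ordered_basis scale vs \<longleftrightarrow>
     distinct vs \<and> \<not> module.dependent scale (set vs) \<and> module.span scale (set vs) = UNIV"

text \<open>Column \<open>j\<close> holds the coordinates of \<open>X (vs ! j)\<close>: if \<open>M\<close> represents \<open>X\<close>, then
  \<open>X (vs ! j) = (\<Sum>i<length vs. scale (M $$ (i, j)) (vs ! i))\<close>.\<close>

definition representing_mat ::
    "('k::field \<Rightarrow> 'v::ab_group_add \<Rightarrow> 'v) \<Rightarrow> 'v list \<Rightarrow> ('v \<Rightarrow> 'v) \<Rightarrow> 'k mat" where
  "representing_mat scale vs X =
     mat (length vs) (length vs)
       (\<lambda>(i, j). module.representation scale (set vs) (X (vs ! j)) (vs ! i))"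

definition Leonard_pair ::
    "('k::field \<Rightarrow> 'v::ab_group_add \<Rightarrow> 'v) \<Rightarrow> ('v \<Rightarrow> 'v) \<Rightarrow> ('v \<Rightarrow> 'v) \<Rightarrow> bool" where
  "Leonard_pair scale A Astar \<longleftrightarrow>
     Vector_Spaces.linear scale scale A \<and> Vector_Spaces.linear scale scale Astar \<and>
     (\<exists>vs. ordered_basis scale vs \<and>
        irreducible_tridiagonal_mat (representing_mat scale vs A) \<and>
        diagonal_mat (representing_mat scale vs Astar)) \<and>
     (\<exists>vs. ordered_basis scale vs \<and>
        irreducible_tridiagonal_mat (representing_mat scale vs Astar) \<and>
        diagonal_mat (representing_mat scale vs A))"

definition invertible_linear ::
    "('k::field \<Rightarrow> 'v::ab_group_add \<Rightarrow> 'v) \<Rightarrow> ('v \<Rightarrow> 'v) \<Rightarrow> bool" where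
  "invertible_linear scale X \<longleftrightarrow> Vector_Spaces.linear scale scale X \<and>
     (\<exists>Y. Vector_Spaces.linear scale scale Y \<and> Y \<circ> X = id \<and> X \<circ> Y = id)"

definition null_space :: "('v::zero \<Rightarrow> 'v) \<Rightarrow> 'v set" where
  "null_space X = {v. X v = 0}"

end

theory Submission
  imports Defs
begin

text \<open>
  Work in a basis \<open>vs\<close> in which \<open>Astar\<close> is diagonal, with entries \<open>\<theta>\<^sub>0, \<dots>, \<theta>\<^sub>d\<close>, and \<open>A\<close> is
  irreducible tridiagonal, with entries \<open>M i j\<close>. The commutator \<open>A Astar - Astar A\<close> then has the
  entries \<open>M i j * (\<theta>\<^sub>j - \<theta>\<^sub>i)\<close>: it is tridiagonal with zero diagonal. Moreover the \<open>\<theta>\<^sub>i\<close> are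
  pairwise distinct, so that it is again irreducible (\<open>Leonard_pair_commutator_matrix\<close>).

  Distinctness uses the other basis, in which \<open>Astar\<close> is irreducible tridiagonal. There an
  eigenvector is determined by its coordinate number 0, because row \<open>i\<close> of the eigenvector equation
  yields coordinate \<open>i + 1\<close> from the preceding ones (\<open>tridiagonal_eigenvector_eq_zero\<close>). Hence the
  eigenspaces of \<open>Astar\<close> are at most one-dimensional, whereas equal diagonal entries
  would give two independent eigenvectors for one eigenvalue (\<open>diagonal_entries_distinct\<close>).

  What remains is the null space of an irreducible tridiagonal matrix \<open>C\<close> of size \<open>d + 1\<close> with zero
  diagonal. By the same forward recursion, a null vector \<open>u\<close> is determined by \<open>u 0\<close>, so the nullity
  is at most 1. Row \<open>i\<close> of \<open>C u = 0\<close> links only \<open>u (i - 1)\<close> and \<open>u (i + 1)\<close>, so the even and the odd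
  coordinates decouple. If \<open>d\<close> is odd, the last row gives \<open>u (d - 1) = 0\<close>, and as \<open>d - 1\<close> is even, this
  propagates down to \<open>u 0 = 0\<close>: the nullity is 0. If \<open>d\<close> is even, the last row
  involves only the odd coordinate \<open>u (d - 1)\<close>, or is zero for \<open>d = 0\<close>; setting all odd coordinates to 0 and solving for the even
  ones from \<open>u 0 = 1\<close> produces a nonzero null vector, so the nullity is 1.
\<close>

section \<open>Null vectors of tridiagonal systems\<close>

text \<open>
  Row \<open>m\<close> has no entry beyond column \<open>m + 1\<close>, where its entry is nonzero; so it expresses
  \<open>u (m + 1)\<close> through the earlier coordinates. The recursion serves both eigenvectors of a
  tridiagonal matrix and null vectors of the commutator.
\<close>

lemma hessenberg_null_vector_eq_zero:
  fixes C :: "nat \<Rightarrow> nat \<Rightarrow> 'k::field"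
  assumes hess: "\<And>i j. Suc i < j \<Longrightarrow> j < n \<Longrightarrow> C i j = 0"
    and super: "\<And>i. Suc i < n \<Longrightarrow> C i (Suc i) \<noteq> 0"
    and null: "\<And>i. i < n \<Longrightarrow> (\<Sum>j<n. C i j * u j) = 0"
    and u0: "u 0 = 0"
  shows "i < n \<Longrightarrow> u i = 0"
proof (induction i rule: less_induct)
  case (less i)
  show ?case
  proof (cases i)
    case 0
    then show ?thesis using u0 by simp
  next
    case (Suc m)
    have "0 = (\<Sum>j<n. C m j * u j)"
      using null[of m] less.prems Suc by simp
    also have "\<dots> = (\<Sum>j\<in>{i}. C m j * u j)"
    proof (rule sum.mono_neutral_right)
      show "\<forall>j\<in>{..<n} - {i}. C m j * u j = 0"
      proof
        fix j assume j: "j \<in> {..<n} - {i}"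
        consider "j < i" | "Suc m < j" using j Suc by force
        then show "C m j * u j = 0"
          using less.IH[of j] hess[of m j] j by cases auto
      qed
    qed (use less.prems in auto)
    finally have "C m i * u i = 0" by simp
    then show ?thesis using super[of m] less.prems Suc by simp
  qed
qed

lemma hollow_tridiagonal_row_sum:
  fixes C :: "nat \<Rightarrow> nat \<Rightarrow> 'k::field"
  assumes supp: "\<And>i j. i < n \<Longrightarrow> j < n \<Longrightarrow> C i j \<noteq> 0 \<Longrightarrow> i = Suc j \<or> j = Suc i"
    and i: "Suc i < n"
  shows "(\<Sum>j<n. C (Suc i) j * u j) =
    C (Suc i) i * u i + (if Suc (Suc i) < n then C (Suc i) (Suc (Suc i)) * u (Suc (Suc i)) else 0)"
proof -
  have "(\<Sum>j<n. C (Suc i) j * u j) = (\<Sum>j\<in>{i, Suc (Suc i)} \<inter> {..<n}. C (Suc i) j * u j)"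
    using supp[OF i] by (intro sum.mono_neutral_right) auto
  also have "\<dots> = C (Suc i) i * u i
      + (if Suc (Suc i) < n then C (Suc i) (Suc (Suc i)) * u (Suc (Suc i)) else 0)"
    using i by (simp add: Int_insert_left)
  finally show ?thesis .
qed

lemma hollow_tridiagonal_first_row_sum:
  fixes C :: "nat \<Rightarrow> nat \<Rightarrow> 'k::field"
  assumes supp: "\<And>i j. i < n \<Longrightarrow> j < n \<Longrightarrow> C i j \<noteq> 0 \<Longrightarrow> i = Suc j \<or> j = Suc i"
    and n: "0 < n"
  shows "(\<Sum>j<n. C 0 j * u j) = (if Suc 0 < n then C 0 (Suc 0) * u (Suc 0) else 0)"
proof -
  have "(\<Sum>j<n. C 0 j * u j) = (\<Sum>j\<in>{Suc 0} \<inter> {..<n}. C 0 j * u j)"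
    using supp[OF n] by (intro sum.mono_neutral_right) auto
  then show ?thesis by (simp add: Int_insert_left)
qed

text \<open>
  If \<open>u 0\<close> were nonzero, the recursion with step 2 would make all even coordinates nonzero. For even
  \<open>n\<close> the coordinate \<open>n - 2\<close> is among them, and the last row forces it to vanish.
\<close>

lemma hollow_tridiagonal_even_size_first_coord:
  fixes C :: "nat \<Rightarrow> nat \<Rightarrow> 'k::field"
  assumes supp: "\<And>i j. i < n \<Longrightarrow> j < n \<Longrightarrow> C i j \<noteq> 0 \<Longrightarrow> i = Suc j \<or> j = Suc i"
    and sub: "\<And>i. Suc i < n \<Longrightarrow> C (Suc i) i \<noteq> 0"
    and null: "\<And>i. i < n \<Longrightarrow> (\<Sum>j<n. C i j * u j) = 0"
    and n: "even n" "0 < n"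
  shows "u 0 = 0"
proof (rule ccontr)
  assume u0: "u 0 \<noteq> 0"
  have row: "C (Suc i) i * u i
      + (if Suc (Suc i) < n then C (Suc i) (Suc (Suc i)) * u (Suc (Suc i)) else 0) = 0"
    if "Suc i < n" for i
    using hollow_tridiagonal_row_sum[of n C i u, OF supp that] null[OF that] by simp
  have nz: "2 * k < n \<Longrightarrow> u (2 * k) \<noteq> 0" for k
  proof (induction k)
    case 0
    then show ?case using u0 by simp
  next
    case (Suc k)
    then show ?case using row[of "2 * k"] sub[of "2 * k"] by auto
  qed
  obtain k where k: "n = Suc (Suc (2 * k))"
    using n by (metis evenE gr0_implies_Suc mult_Suc_right mult_zero_right add_2_eq_Suc neq0_conv)
  \<comment> \<open>Row \<open>n - 1 = Suc (2 * k)\<close> is the last one: its only possible entry is \<open>C (n - 1) (n - 2)\<close>.\<close>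
  show False
    using row[of "2 * k"] sub[of "2 * k"] nz[of k] k by simp
qed

text \<open>
  The third equation solves row \<open>i + 1\<close> of the system for \<open>u (i + 2)\<close>. Row 0 of a system of size at
  least 2 forces the value 0 at 1.
\<close>

fun even_null_vector :: "(nat \<Rightarrow> nat \<Rightarrow> 'k::field) \<Rightarrow> nat \<Rightarrow> 'k" where
  "even_null_vector C 0 = 1"
| "even_null_vector C (Suc 0) = 0"
| "even_null_vector C (Suc (Suc i)) =
     - (C (Suc i) i * even_null_vector C i) / C (Suc i) (Suc (Suc i))"

lemma even_null_vector_odd: "odd i \<Longrightarrow> even_null_vector C i = 0"
  by (induction C i rule: even_null_vector.induct) auto

text \<open>
  All rows but the last hold by construction. For odd \<open>n\<close> the last row reads
  \<open>C (n - 1) (n - 2) * u (n - 2) = 0\<close> (or \<open>0 = 0\<close> if \<open>n = 1\<close>), and \<open>n - 2\<close> is odd.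
\<close>

lemma even_null_vector_null:
  fixes C :: "nat \<Rightarrow> nat \<Rightarrow> 'k::field"
  assumes supp: "\<And>i j. i < n \<Longrightarrow> j < n \<Longrightarrow> C i j \<noteq> 0 \<Longrightarrow> i = Suc j \<or> j = Suc i"
    and super: "\<And>i. Suc i < n \<Longrightarrow> C i (Suc i) \<noteq> 0"
    and n: "odd n" and i: "i < n"
  shows "(\<Sum>j<n. C i j * even_null_vector C j) = 0"
proof (cases i)
  case 0
  then show ?thesis
    using hollow_tridiagonal_first_row_sum[of n C "even_null_vector C", OF supp] i by simp
next
  case (Suc m)
  show ?thesis
  proof (cases "Suc i < n")
    case True
    then show ?thesis
      using hollow_tridiagonal_row_sum[of n C m "even_null_vector C", OF supp] super[of i] Suc i
      by simp
  next
    case False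
    then have "n = Suc (Suc m)" using i Suc by simp
    then have "odd m" using n by simp
    then show ?thesis
      using hollow_tridiagonal_row_sum[of n C m "even_null_vector C", OF supp] False Suc i
      by (simp add: even_null_vector_odd)
  qed
qed

section \<open>Coordinates with respect to an ordered basis\<close>

definition coord ::
    "('k::field \<Rightarrow> 'v::ab_group_add \<Rightarrow> 'v) \<Rightarrow> 'v list \<Rightarrow> 'v \<Rightarrow> nat \<Rightarrow> 'k" where
  "coord scale vs w i = module.representation scale (set vs) w (vs ! i)"

context vector_space
begin

lemma ordered_basisD:
  assumes "ordered_basis scale vs"
  shows "distinct vs" "independent (set vs)" "span (set vs) = UNIV"
  using assms by (auto simp: ordered_basis_def)

lemma coord_arith:
  assumes "ordered_basis scale vs"
  shows "coord scale vs (v + w) i = coord scale vs v i + coord scale vs w i"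
    and "coord scale vs (v - w) i = coord scale vs v i - coord scale vs w i"
    and "coord scale vs (scale c v) i = c * coord scale vs v i"
    and "coord scale vs 0 i = 0"
  using ordered_basisD[OF assms]
  by (simp_all add: coord_def representation_add representation_diff representation_scale
      representation_zero)

lemma coord_sum:
  assumes "ordered_basis scale vs"
  shows "coord scale vs (\<Sum>x\<in>S. f x) i = (\<Sum>x\<in>S. coord scale vs (f x) i)"
  by (induction S rule: infinite_finite_induct) (simp_all add: coord_arith[OF assms])

lemma coord_nth:
  assumes "ordered_basis scale vs" "i < length vs" "j < length vs"
  shows "coord scale vs (vs ! j) i = (if i = j then 1 else 0)"
  using ordered_basisD[OF assms(1)] assms(2,3)
  by (simp add: coord_def representation_basis nth_eq_iff_index_eq eq_commute)

lemma sum_coord_eq: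
  assumes "ordered_basis scale vs"
  shows "(\<Sum>i<length vs. scale (coord scale vs w i) (vs ! i)) = w"
proof -
  note b = ordered_basisD[OF assms]
  have "(\<Sum>i<length vs. scale (coord scale vs w i) (vs ! i))
      = (\<Sum>v\<in>set vs. scale (representation (set vs) w v) v)"
    unfolding coord_def
    by (rule sum.reindex_bij_betw[OF bij_betw_nth[OF b(1) refl refl]])
  also have "\<dots> = w"
    by (rule sum_representation_eq) (use b in auto)
  finally show ?thesis .
qed

lemma coord_sum_scale_nth:
  assumes "ordered_basis scale vs" "i < length vs"
  shows "coord scale vs (\<Sum>j<length vs. scale (u j) (vs ! j)) i = u i"
  using assms
  by (simp add: coord_sum coord_arith coord_nth if_distrib[of "\<lambda>c. _ * c"] cong: if_cong)

lemma coord_eq_zero_imp_eq_zero: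
  assumes "ordered_basis scale vs" "\<And>i. i < length vs \<Longrightarrow> coord scale vs w i = 0"
  shows "w = 0"
  using sum_coord_eq[OF assms(1), of w] assms(2) by simp

lemma coord_linear:
  assumes vs: "ordered_basis scale vs" and X: "Vector_Spaces.linear scale scale X"
    and i: "i < length vs"
  shows "coord scale vs (X w) i
    = (\<Sum>j<length vs. representing_mat scale vs X $$ (i, j) * coord scale vs w j)"
proof -
  interpret X: Vector_Spaces.linear scale scale X by fact
  have "X w = X (\<Sum>j<length vs. scale (coord scale vs w j) (vs ! j))"
    by (simp add: sum_coord_eq[OF vs])
  also have "\<dots> = (\<Sum>j<length vs. scale (coord scale vs w j) (X (vs ! j)))"
    by (simp add: X.sum X.scale)
  finally have "coord scale vs (X w) i = (\<Sum>j<length vs. coord scale vs w j * coord scale vs (X (vs ! j)) i)"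
    by (simp add: coord_sum[OF vs] coord_arith[OF vs])
  then show ?thesis
    using i by (simp add: representing_mat_def coord_def mult.commute)
qed

section \<open>Leonard pairs\<close>

text \<open>
  Subtracting \<open>\<theta>\<close> on the diagonal leaves the superdiagonal nonzero, so an eigenvector is a null vector
  to which the forward recursion applies: eigenspaces have dimension at most 1.
\<close>

lemma tridiagonal_eigenvector_eq_zero:
  assumes vs: "ordered_basis scale vs" and X: "Vector_Spaces.linear scale scale X"
    and tri: "irreducible_tridiagonal_mat (representing_mat scale vs X)"
    and eig: "X w = scale \<theta> w" and w0: "coord scale vs w 0 = 0"
  shows "w = 0"
proof -
  define M where "M = representing_mat scale vs X"
  define C where "C i j = M $$ (i, j) - (if i = j then \<theta> else 0)" for i j
  let ?n = "length vs"
  have dims: "dim_row M = ?n" "dim_col M = ?n"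
    by (simp_all add: M_def representing_mat_def)
  note tri' = tri[folded M_def, unfolded irreducible_tridiagonal_mat_def tridiagonal_mat_def dims]
  have "coord scale vs w i = 0" if "i < ?n" for i
  proof (rule hessenberg_null_vector_eq_zero[of ?n C, OF _ _ _ _ that])
    show "C i j = 0" if "Suc i < j" "j < ?n" for i j
      using tri'[THEN conjunct1, THEN conjunct2, THEN spec[of _ i], THEN mp, THEN spec[of _ j]] that
      by (auto simp: C_def)
    show "C i (Suc i) \<noteq> 0" if "Suc i < ?n" for i
      using tri' that by (simp add: C_def)
    show "(\<Sum>j<?n. C i j * coord scale vs w j) = 0" if "i < ?n" for i
    proof -
      have "(\<Sum>j<?n. C i j * coord scale vs w j)
          = (\<Sum>j<?n. M $$ (i, j) * coord scale vs w j) - \<theta> * coord scale vs w i"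
        using that by (simp add: C_def left_diff_distrib sum_subtractf if_distrib[of "\<lambda>c. c * _"]
            cong: if_cong)
      also have "\<dots> = coord scale vs (X w) i - \<theta> * coord scale vs w i"
        using coord_linear[OF vs X that] by (simp add: M_def)
      also have "\<dots> = 0"
        by (simp add: eig coord_arith[OF vs])
      finally show ?thesis .
    qed
  qed (rule w0)
  then show ?thesis
    by (rule coord_eq_zero_imp_eq_zero[OF vs])
qed

lemma diagonal_apply_nth:
  assumes vs: "ordered_basis scale vs" and X: "Vector_Spaces.linear scale scale X"
    and diag: "diagonal_mat (representing_mat scale vs X)" and i: "i < length vs"
  shows "X (vs ! i) = scale (representing_mat scale vs X $$ (i, i)) (vs ! i)"
proof -
  define M where "M = representing_mat scale vs X"
  have dims: "dim_row M = length vs" "dim_col M = length vs"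
    by (simp_all add: M_def representing_mat_def)
  have "X (vs ! i) - scale (M $$ (i, i)) (vs ! i) = 0"
  proof (rule coord_eq_zero_imp_eq_zero[OF vs])
    fix j assume j: "j < length vs"
    have "coord scale vs (X (vs ! i)) j = M $$ (j, i)"
      using i j by (simp add: M_def representing_mat_def coord_def)
    then show "coord scale vs (X (vs ! i) - scale (M $$ (i, i)) (vs ! i)) j = 0"
      using diag[folded M_def] i j dims
      by (auto simp: coord_arith[OF vs] coord_nth[OF vs] diagonal_mat_def)
  qed
  then show ?thesis by (simp add: M_def)
qed

text \<open>
  Two basis vectors with a common eigenvalue have a nontrivial combination whose coordinate number 0
  with respect to \<open>ws\<close> vanishes. This combination is itself an eigenvector, hence zero,
  against independence.
\<close>

lemma diagonal_entries_distinct: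
  assumes X: "Vector_Spaces.linear scale scale X"
    and ws: "ordered_basis scale ws" "irreducible_tridiagonal_mat (representing_mat scale ws X)"
    and vs: "ordered_basis scale vs" "diagonal_mat (representing_mat scale vs X)"
    and ij: "i < length vs" "j < length vs" "i \<noteq> j"
  shows "representing_mat scale vs X $$ (i, i) \<noteq> representing_mat scale vs X $$ (j, j)"
proof
  interpret X: Vector_Spaces.linear scale scale X by fact
  define \<theta> where "\<theta> = representing_mat scale vs X $$ (i, i)"
  assume "representing_mat scale vs X $$ (i, i) = representing_mat scale vs X $$ (j, j)"
  then have eig: "X (vs ! i) = scale \<theta> (vs ! i)" "X (vs ! j) = scale \<theta> (vs ! j)"
    using diagonal_apply_nth[OF vs(1) X vs(2)] ij by (simp_all add: \<theta>_def)
  define a b where "a = coord scale ws (vs ! i) 0" and "b = coord scale ws (vs ! j) 0"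
  define w where "w = scale b (vs ! i) - scale a (vs ! j)"
  have "X w = scale \<theta> w"
    by (simp add: w_def X.diff X.scale eig scale_right_diff_distrib mult.commute)
  moreover have "coord scale ws w 0 = 0"
    by (simp add: w_def coord_arith[OF ws(1)] a_def b_def)
  ultimately have "w = 0"
    by (rule tridiagonal_eigenvector_eq_zero[OF ws(1) X ws(2)])
  \<comment> \<open>The coefficient of \<open>vs ! j\<close> in \<open>w = 0\<close> is \<open>- a\<close>; so \<open>vs ! i\<close> itself has coordinate 0 at 0.\<close>
  then have "coord scale vs w j = 0"
    by (simp add: coord_arith[OF vs(1)])
  then have "a = 0"
    using ij by (simp add: w_def coord_arith[OF vs(1)] coord_nth[OF vs(1)])
  then have "vs ! i = 0"
    using tridiagonal_eigenvector_eq_zero[OF ws(1) X ws(2) eig(1)] by (simp add: a_def)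
  then show False
    using coord_nth[OF vs(1) ij(1) ij(1)] by (simp add: coord_arith[OF vs(1)])
qed

text \<open>
  With \<open>Astar\<close> diagonal, the commutator has the entries \<open>M i j * (D j j - D i i)\<close>. The second factor
  kills the diagonal and, by distinctness, preserves the nonzero entries next to it.
\<close>

lemma Leonard_pair_commutator_matrix:
  assumes "Leonard_pair scale A Astar"
  obtains vs C where "ordered_basis scale vs"
    and "\<And>w i. i < length vs \<Longrightarrow>
      coord scale vs (A (Astar w) - Astar (A w)) i = (\<Sum>j<length vs. C i j * coord scale vs w j)"
    and "\<And>i j. i < length vs \<Longrightarrow> j < length vs \<Longrightarrow> C i j \<noteq> 0 \<Longrightarrow> i = Suc j \<or> j = Suc i"
    and "\<And>i. Suc i < length vs \<Longrightarrow> C (Suc i) i \<noteq> 0 \<and> C i (Suc i) \<noteq> 0"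
proof -
  from assms obtain vs ws where A: "Vector_Spaces.linear scale scale A"
    and As: "Vector_Spaces.linear scale scale Astar"
    and vs: "ordered_basis scale vs" "diagonal_mat (representing_mat scale vs Astar)"
    and triA: "irreducible_tridiagonal_mat (representing_mat scale vs A)"
    and ws: "ordered_basis scale ws" "irreducible_tridiagonal_mat (representing_mat scale ws Astar)"
    by (auto simp: Leonard_pair_def)
  define M where "M = representing_mat scale vs A"
  define D where "D = representing_mat scale vs Astar"
  define C where "C i j = M $$ (i, j) * (D $$ (j, j) - D $$ (i, i))" for i j
  let ?n = "length vs"
  have dims: "dim_row M = ?n" "dim_col M = ?n" "dim_row D = ?n" "dim_col D = ?n"
    by (simp_all add: M_def D_def representing_mat_def)
  note tri = triA[folded M_def, unfolded irreducible_tridiagonal_mat_def tridiagonal_mat_def dims]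
  have D_distinct: "D $$ (i, i) \<noteq> D $$ (j, j)" if "i < ?n" "j < ?n" "i \<noteq> j" for i j
    unfolding D_def by (rule diagonal_entries_distinct[OF As ws vs that])
  have coord_As: "coord scale vs (Astar w) i = D $$ (i, i) * coord scale vs w i" if "i < ?n" for w i
  proof -
    have "coord scale vs (Astar w) i = (\<Sum>j<?n. D $$ (i, j) * coord scale vs w j)"
      using coord_linear[OF vs(1) As that] by (simp add: D_def)
    also have "\<dots> = (\<Sum>j\<in>{i}. D $$ (i, j) * coord scale vs w j)"
      using vs(2) that dims
      by (intro sum.mono_neutral_right) (auto simp: diagonal_mat_def D_def)
    finally show ?thesis by simp
  qed
  have coord_A: "coord scale vs (A w) i = (\<Sum>j<?n. M $$ (i, j) * coord scale vs w j)" if "i < ?n" for w i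
    using coord_linear[OF vs(1) A that] by (simp add: M_def)
  show ?thesis
  proof (rule that[OF vs(1), of C])
    fix w i assume i: "i < ?n"
    have "coord scale vs (A (Astar w) - Astar (A w)) i
        = (\<Sum>j<?n. M $$ (i, j) * (D $$ (j, j) * coord scale vs w j))
          - D $$ (i, i) * (\<Sum>j<?n. M $$ (i, j) * coord scale vs w j)"
      using i by (simp add: coord_arith[OF vs(1)] coord_As coord_A)
    also have "\<dots> = (\<Sum>j<?n. C i j * coord scale vs w j)"
      by (simp add: C_def sum_distrib_left flip: sum_subtractf) (simp add: algebra_simps)
    finally show "coord scale vs (A (Astar w) - Astar (A w)) i = (\<Sum>j<?n. C i j * coord scale vs w j)" .
  next
    fix i j assume "i < ?n" "j < ?n" "C i j \<noteq> 0"
    then show "i = Suc j \<or> j = Suc i" using tri unfolding C_def by fastforce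
  next
    fix i assume "Suc i < ?n"
    then show "C (Suc i) i \<noteq> 0 \<and> C i (Suc i) \<noteq> 0"
      using tri D_distinct[of i "Suc i"] by (auto simp: C_def)
  qed
qed

lemma linear_commutator:
  assumes "Vector_Spaces.linear scale scale X" "Vector_Spaces.linear scale scale Y"
  shows "Vector_Spaces.linear scale scale (\<lambda>v. X (Y v) - Y (X v))"
proof -
  interpret X: Vector_Spaces.linear scale scale X by fact
  interpret Y: Vector_Spaces.linear scale scale Y by fact
  show ?thesis
    by unfold_locales (simp_all add: X.add Y.add X.scale Y.scale scale_right_diff_distrib)
qed

end

lemma (in finite_dimensional_vector_space) invertible_linear_if_trivial_null_space:
  assumes X: "Vector_Spaces.linear scale scale X" and null: "\<And>w. X w = 0 \<Longrightarrow> w = 0"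
  shows "invertible_linear scale X"
proof -
  interpret X: Vector_Spaces.linear scale scale X by fact
  interpret P: finite_dimensional_vector_space_pair scale Basis scale Basis ..
  have "inj X"
  proof (rule injI)
    fix x y assume "X x = X y"
    then show "x = y" using null[of "x - y"] by (simp add: X.diff)
  qed
  then obtain Y where "Vector_Spaces.linear scale scale Y" "\<forall>x. Y (X x) = x" "\<forall>x. X (Y x) = x"
    using P.linear_injective_isomorphism[OF X] by auto
  then show ?thesis
    using X by (auto simp: invertible_linear_def fun_eq_iff)
qed

theorem theorem1p3:
  fixes scale :: "'k::field \<Rightarrow> 'v::ab_group_add \<Rightarrow> 'v"
    and Basis :: "'v set"
    and A Astar :: "'v \<Rightarrow> 'v"
    and d :: nat
  assumes "finite_dimensional_vector_space scale Basis"
    and "vector_space.dim scale (UNIV :: 'v set) > 0"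
    and "Leonard_pair scale A Astar"
    and "d = vector_space.dim scale (UNIV :: 'v set) - 1"
  shows "(odd d \<longrightarrow>
            invertible_linear scale (\<lambda>v. A (Astar v) - Astar (A v))) \<and>
         (even d \<longrightarrow>
            vector_space.dim scale
              (null_space (\<lambda>v. A (Astar v) - Astar (A v))) = 1)"
proof -
  interpret finite_dimensional_vector_space scale Basis by fact
  define K where "K w = A (Astar w) - Astar (A w)" for w
  have K_linear: "Vector_Spaces.linear scale scale K"
    using linear_commutator assms(3) unfolding K_def Leonard_pair_def by blast
  interpret K: Vector_Spaces.linear scale scale K by (rule K_linear)
  obtain vs C where vs: "ordered_basis scale vs"
    and coord_K: "\<And>w i. i < length vs \<Longrightarrow> coord scale vs (K w) i = (\<Sum>j<length vs. C i j * coord scale vs w j)"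
    and supp: "\<And>i j. i < length vs \<Longrightarrow> j < length vs \<Longrightarrow> C i j \<noteq> 0 \<Longrightarrow> i = Suc j \<or> j = Suc i"
    and nz: "\<And>i. Suc i < length vs \<Longrightarrow> C (Suc i) i \<noteq> 0 \<and> C i (Suc i) \<noteq> 0"
    unfolding K_def using Leonard_pair_commutator_matrix[OF assms(3)] by blast
  let ?n = "length vs"
  have "dim UNIV = ?n"
    using dim_eq_card[of "set vs" UNIV] ordered_basisD[OF vs] by (simp add: distinct_card)
  then have n: "?n = Suc d"
    using assms(2,4) by simp
  have null_coord: "(\<Sum>j<?n. C i j * coord scale vs w j) = 0" if "K w = 0" "i < ?n" for w i
    using coord_K[OF that(2), of w] that(1) by (simp add: coord_arith[OF vs])
  have null_zero: "w = 0" if "K w = 0" "coord scale vs w 0 = 0" for w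
  proof (rule coord_eq_zero_imp_eq_zero[OF vs])
    fix i assume "i < ?n"
    then show "coord scale vs w i = 0"
    proof (rule hessenberg_null_vector_eq_zero[of ?n C, rotated 4])
      show "C i j = 0" if "Suc i < j" "j < ?n" for i j
        using supp[of i j] that by force
    qed (use nz null_coord that in auto)
  qed
  have "invertible_linear scale K" if "odd d"
  proof (rule invertible_linear_if_trivial_null_space[OF K_linear])
    fix w assume w: "K w = 0"
    have "coord scale vs w 0 = 0"
      by (rule hollow_tridiagonal_even_size_first_coord[of ?n C])
        (use supp nz null_coord[OF w] n that in auto)
    with w show "w = 0" by (rule null_zero)
  qed
  moreover have "dim (null_space K) = 1" if "even d"
  proof -
    define w where "w = (\<Sum>j<?n. scale (even_null_vector C j) (vs ! j))"
    have coord_w: "coord scale vs w i = even_null_vector C i" if "i < ?n" for i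
      unfolding w_def by (rule coord_sum_scale_nth[OF vs that])
    have w0: "coord scale vs w 0 = 1"
      using coord_w[of 0] n by simp
    then have "w \<noteq> 0" by (auto simp: coord_arith[OF vs])
    have Kw: "K w = 0"
    proof (rule coord_eq_zero_imp_eq_zero[OF vs])
      fix i assume i: "i < ?n"
      then have "coord scale vs (K w) i = (\<Sum>j<?n. C i j * even_null_vector C j)"
        by (simp add: coord_K coord_w)
      also have "\<dots> = 0"
        by (rule even_null_vector_null[of ?n C]) (use supp nz n i \<open>even d\<close> in auto)
      finally show "coord scale vs (K w) i = 0" .
    qed
    have "null_space K = span {w}"
    proof
      show "span {w} \<subseteq> null_space K"
        using Kw by (auto simp: span_singleton null_space_def K.scale)
      show "null_space K \<subseteq> span {w}"
      proof
        fix z assume "z \<in> null_space K"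
        \<comment> \<open>Subtract the multiple of \<open>w\<close> that agrees with \<open>z\<close> in coordinate 0.\<close>
        then have "K (z - scale (coord scale vs z 0) w) = 0"
          using Kw by (simp add: null_space_def K.diff K.scale)
        moreover have "coord scale vs (z - scale (coord scale vs z 0) w) 0 = 0"
          by (simp add: coord_arith[OF vs] w0)
        ultimately have "z - scale (coord scale vs z 0) w = 0"
          by (rule null_zero)
        then show "z \<in> span {w}" by (auto simp: span_singleton)
      qed
    qed
    then show ?thesis
      using dim_span_eq_card_independent[of "{w}"] \<open>w \<noteq> 0\<close> by simp
  qed
  ultimately show ?thesis by (simp add: K_def[abs_def])
qed

end
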